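(* Let $k\ge1$ and $n\ge 1$ be integers, $V=\mathbb{R}^n$, and let $H\colon V\to\mathbb{R}$ (the Hamiltonian) be a nonzero homogeneous polynomial of degree $k+2$. Let $\mathsf{H}\colon V^{k+2}\to\mathbb{R}$ be the symmetric $(k+2)$-tensor (symmetric multilinear form) such that $H(x)=\frac{1}{(k+2)!}\mathsf{H}(x,x,\dots,x)$. Let $\Omega$ be a constant invertible antisymmetric $n\times n$ real matrix, let $\omega\colon V\times V\to\mathbb{R}$, $\omega(u,v)=u^T\Omega v$, be its associated symplectic form, and let $K=\Omega^{-1}$. Let $h\neq 0$ be the time step. Then: (i) the Hamiltonian ODE on $V$ associated with $(H,\Omega)$ is $$\dot x=\frac{1}{(k+1)!}K\,\mathsf{H}(x,\dots,x,\cdot);$$ (ii) the associated polar map $(x_0,\dots,x_{k-1})\mapsto(x_1,\dots,x_k)$ is defined via $$\frac{x_k-x_0}{kh}=\frac{1}{(k+1)!}K\,\mathsf{H}(x_0,\dots,x_k,\cdot);$$ (iii) this polar map has $k$ independent $k$-integrals $$\omega(x_0,x_1),\ \omega(x_1,x_2),\ \dots,\ \omega(x_{k-1},x_k),$$ where $x_k$ is regarded as the function of $(x_0,\dots,x_{k-1})$ determined by the equation in (ii).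
   Context: The Hamiltonian ODE associated with $(H,\Omega)$ is $\dot x=\Omega^{-1}\nabla H(x)$. For a multilinear form, $\mathsf{H}(x_0,\dots,x_k,\cdot)$ denotes the linear functional $v\mapsto\mathsf{H}(x_0,\dots,x_k,v)$, identified with the column vector $w\in\mathbb{R}^n$ such that $w^Tv=\mathsf{H}(x_0,\dots,x_k,v)$ for all $v$. Polar map: given a homogeneous polynomial vector field $f$ of degree $k+1$ on $V=\mathbb{R}^n$, let $F\colon V^{k+1}\to\mathbb{R}^n$ be the symmetric multilinear map with $F(x,\dots,x)=f(x)$. The polar map of $\dot x=f(x)$ with time step $h$ is the birational map on $V^k$ given by $(x_0,\dots,x_{k-1})\mapsto(x_1,\dots,x_k)$, where $x_k$ is the solution of the linear system $\frac{x_k-x_0}{kh}=F(x_0,\dots,x_k)$ (considered where this system is uniquely solvable). A $k$-integral of a map is a function invariant under the $k$th iterate of the map (wherever the iterates are defined). Functions are independent if they are functionally independent, i.e. their differentials are linearly independent on a dense open subset of $V^k$. *)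

theory Defs
  imports "HOL-Analysis.Analysis"
begin

section \<open>Homogeneous polynomials and symmetric multilinear maps\<close>

definition homogeneous_polynomial :: "nat \<Rightarrow> (real ^ 'n \<Rightarrow> real) \<Rightarrow> bool" where
  "homogeneous_polynomial d p \<longleftrightarrow>
     (\<exists>c :: ('n \<Rightarrow> nat) \<Rightarrow> real. \<forall>x.
        p x = (\<Sum>\<alpha> | (\<Sum>i\<in>UNIV. \<alpha> i) = d. c \<alpha> * (\<Prod>i\<in>UNIV. (x $ i) ^ \<alpha> i)))"

text \<open>The index set of the sum above is finite, so the sum is not vacuously zero.\<close>

lemma finite_multi_indices: "finite {\<alpha> :: 'n::finite \<Rightarrow> nat. (\<Sum>i\<in>UNIV. \<alpha> i) = d}"
proof (rule finite_subset)
  show "{\<alpha> :: 'n \<Rightarrow> nat. (\<Sum>i\<in>UNIV. \<alpha> i) = d} \<subseteq> PiE UNIV (\<lambda>_. {..d})"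
    by (auto intro: member_le_sum)
  show "finite (PiE (UNIV :: 'n set) (\<lambda>_. {..d}))"
    by (intro finite_PiE) auto
qed

text \<open>
  An \<open>m\<close>-tuple of vectors is a function on \<open>nat\<close> of which only the values at
  \<open>0, \<dots>, m - 1\<close> matter; a map of \<open>m\<close> arguments must ignore the other values.
\<close>

definition multilinear_map ::
    "nat \<Rightarrow> ((nat \<Rightarrow> 'a::real_vector) \<Rightarrow> 'b::real_vector) \<Rightarrow> bool" where
  "multilinear_map m M \<longleftrightarrow>
     (\<forall>z w. (\<forall>i<m. z i = w i) \<longrightarrow> M z = M w) \<and>
     (\<forall>z. \<forall>i<m. linear (\<lambda>v. M (z(i := v))))"

definition symmetric_map :: "nat \<Rightarrow> ((nat \<Rightarrow> 'a) \<Rightarrow> 'b) \<Rightarrow> bool" where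
  "symmetric_map m M \<longleftrightarrow> (\<forall>p z. p permutes {..<m} \<longrightarrow> M (z \<circ> p) = M z)"

definition polarization ::
    "nat \<Rightarrow> ('a::real_vector \<Rightarrow> 'b::real_vector) \<Rightarrow> (nat \<Rightarrow> 'a) \<Rightarrow> 'b" where
  "polarization m f =
     (THE F. multilinear_map m F \<and> symmetric_map m F \<and> (\<forall>x. F (\<lambda>_. x) = f x))"

definition column_vector :: "(real ^ 'n \<Rightarrow> real) \<Rightarrow> real ^ 'n" where
  "column_vector l = (THE w. \<forall>v. w \<bullet> v = l v)"

text \<open>\<open>contract k T z\<close> is \<open>T(z\<^sub>0, \<dots>, z\<^sub>k, \<cdot>)\<close> as a column vector.\<close>

definition contract ::
    "nat \<Rightarrow> ((nat \<Rightarrow> real ^ 'n) \<Rightarrow> real) \<Rightarrow> (nat \<Rightarrow> real ^ 'n) \<Rightarrow> real ^ 'n" where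
  "contract k T z = column_vector (\<lambda>v. T (z(Suc k := v)))"


section \<open>Hamiltonian vector fields\<close>

definition gradient :: "(real ^ 'n \<Rightarrow> real) \<Rightarrow> real ^ 'n \<Rightarrow> real ^ 'n" where
  "gradient H x = (THE D. GDERIV H x :> D)"

definition hamiltonian_vf ::
    "real ^ 'n ^ 'n \<Rightarrow> (real ^ 'n \<Rightarrow> real) \<Rightarrow> real ^ 'n \<Rightarrow> real ^ 'n" where
  "hamiltonian_vf \<Omega> H x = matrix_inv \<Omega> *v gradient H x"

definition symplectic_form :: "real ^ 'n ^ 'n \<Rightarrow> real ^ 'n \<Rightarrow> real ^ 'n \<Rightarrow> real" where
  "symplectic_form \<Omega> u v = u \<bullet> (\<Omega> *v v)"


section \<open>The polar map\<close>

text \<open>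
  The space \<open>V\<^sup>k\<close> is the Euclidean space \<open>(real ^ 'n) ^ 'k\<close>, where \<open>'k\<close> is a type with
  \<open>k\<close> elements, numbered by a bijection \<open>e\<close> from \<open>{0, \<dots>, k - 1}\<close>: the entry \<open>x\<^sub>i\<close> of a
  point \<open>x\<close> of \<open>V\<^sup>k\<close> is \<open>x $ e i\<close>. Partially defined maps are modelled by option types.

  \<open>extend e k x v\<close> is the tuple \<open>(x\<^sub>0, \<dots>, x\<^bsub>k-1\<^esub>, v)\<close>.
\<close>

definition extend ::
    "(nat \<Rightarrow> 'k) \<Rightarrow> nat \<Rightarrow> 'a ^ 'k \<Rightarrow> 'a \<Rightarrow> nat \<Rightarrow> 'a" where
  "extend e k x v = (\<lambda>i. if i < k then x $ e i else v)"

text \<open>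
  For a condition \<open>E\<close> on tuples \<open>(x\<^sub>0, \<dots>, x\<^sub>k)\<close>, \<open>next_point\<close> is the partial function
  sending \<open>(x\<^sub>0, \<dots>, x\<^bsub>k-1\<^esub>)\<close> to the \<open>x\<^sub>k\<close> determined by \<open>E\<close>, and \<open>step_map\<close> the partial
  map \<open>(x\<^sub>0, \<dots>, x\<^bsub>k-1\<^esub>) \<mapsto> (x\<^sub>1, \<dots>, x\<^sub>k)\<close>. Both are defined exactly where \<open>E\<close> has a
  unique solution.
\<close>

definition next_point ::
    "(nat \<Rightarrow> 'k::finite) \<Rightarrow> nat \<Rightarrow> ((nat \<Rightarrow> 'a) \<Rightarrow> bool) \<Rightarrow> 'a ^ 'k \<rightharpoonup> 'a" where
  "next_point e k E x =
     (if \<exists>!v. E (extend e k x v) then Some (THE v. E (extend e k x v)) else None)"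

definition step_map ::
    "(nat \<Rightarrow> 'k::finite) \<Rightarrow> nat \<Rightarrow> ((nat \<Rightarrow> 'a) \<Rightarrow> bool) \<Rightarrow> 'a ^ 'k \<rightharpoonup> 'a ^ 'k" where
  "step_map e k E x =
     map_option (\<lambda>v. \<chi> j. extend e k x v (Suc (inv_into {..<k} e j))) (next_point e k E x)"

definition polar_equation ::
    "nat \<Rightarrow> real \<Rightarrow> (real ^ 'n \<Rightarrow> real ^ 'n) \<Rightarrow> (nat \<Rightarrow> real ^ 'n) \<Rightarrow> bool" where
  "polar_equation k h f z \<longleftrightarrow> (z k - z 0) /\<^sub>R (real k * h) = polarization (Suc k) f z"

definition polar_map ::
    "(nat \<Rightarrow> 'k::finite) \<Rightarrow> nat \<Rightarrow> real \<Rightarrow> (real ^ 'n \<Rightarrow> real ^ 'n) \<Rightarrow>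
     real ^ 'n ^ 'k \<rightharpoonup> real ^ 'n ^ 'k" where
  "polar_map e k h f = step_map e k (polar_equation k h f)"


section \<open>Integrals of partial maps\<close>

definition partial_iterate :: "nat \<Rightarrow> ('a \<rightharpoonup> 'a) \<Rightarrow> 'a \<rightharpoonup> 'a" where
  "partial_iterate m \<phi> = (((\<circ>\<^sub>m) \<phi>) ^^ m) Some"

definition iterate_integral :: "nat \<Rightarrow> ('a \<rightharpoonup> 'a) \<Rightarrow> ('a \<rightharpoonup> real) \<Rightarrow> bool" where
  "iterate_integral m \<phi> I \<longleftrightarrow>
     (\<forall>x y. partial_iterate m \<phi> x = Some y \<longrightarrow> x \<in> dom I \<longrightarrow> y \<in> dom I \<longrightarrow> I y = I x)"

definition functionally_independent ::
    "nat \<Rightarrow> (nat \<Rightarrow> 'a::real_normed_vector \<rightharpoonup> real) \<Rightarrow> bool" where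
  "functionally_independent m I \<longleftrightarrow>
     (\<exists>U. open U \<and> closure U = UNIV \<and> (\<forall>i<m. U \<subseteq> dom (I i)) \<and>
        (\<forall>x\<in>U. \<exists>D.
           (\<forall>i<m. ((\<lambda>y. the (I i y)) has_derivative D i) (at x)) \<and>
           (\<forall>c :: nat \<Rightarrow> real. (\<forall>v. (\<Sum>i<m. c i * D i v) = 0) \<longrightarrow> (\<forall>i<m. c i = 0))))"

text \<open>
  \<open>consecutive_pairing e k E \<Omega> i\<close> is \<open>\<omega>(x\<^sub>i, x\<^bsub>i+1\<^esub>)\<close> as a function of \<open>(x\<^sub>0, \<dots>, x\<^bsub>k-1\<^esub>)\<close>,
  for \<open>i < k\<close>. It is total for \<open>i + 1 < k\<close>; for \<open>i + 1 = k\<close> the entry \<open>x\<^sub>k\<close> is determined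
  by \<open>E\<close>.
\<close>

definition consecutive_pairing ::
    "(nat \<Rightarrow> 'k::finite) \<Rightarrow> nat \<Rightarrow> ((nat \<Rightarrow> real ^ 'n) \<Rightarrow> bool) \<Rightarrow> real ^ 'n ^ 'n \<Rightarrow>
     nat \<Rightarrow> real ^ 'n ^ 'k \<rightharpoonup> real" where
  "consecutive_pairing e k E \<Omega> i x =
     (if Suc i < k then Some (symplectic_form \<Omega> (x $ e i) (x $ e (Suc i)))
      else map_option (symplectic_form \<Omega> (x $ e i)) (next_point e k E x))"

end

theory Submission
  imports Defs
begin

text \<open>
  Both the gradient and the polarization are obtained by differentiating multilinear maps along
  the diagonal. For the integrals, with \<open>z\<close> a solution of the recurrence, pair the equation at
  \<open>z\<^sub>0\<close> with \<open>z\<^bsub>k+1\<^esub>\<close> and the equation at \<open>z\<^sub>1\<close> with \<open>z\<^sub>0\<close>: the right-hand sides agree by symmetry of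
  the tensor, which leaves \<open>\<omega>(z\<^sub>k, z\<^bsub>k+1\<^esub>) = \<omega>(z\<^sub>0, z\<^sub>1)\<close>.

  For independence, by Cramer's rule \<open>\<omega>(x\<^bsub>k-1\<^esub>, x\<^sub>k)\<close> is a quotient of polynomials. Its derivative in
  a direction annihilated by the differentials of the other integrals is a rational function, which
  is shown to be nonzero by expanding at a degenerate point; hence it is nonzero on an open dense set.
\<close>

section \<open>Multilinear maps and polarization\<close>

lemma multilinear_map_cong:
  "multilinear_map m M \<Longrightarrow> (\<And>i. i < m \<Longrightarrow> z i = w i) \<Longrightarrow> M z = M w"
  unfolding multilinear_map_def by blast

lemma multilinear_map_linear:
  "multilinear_map m M \<Longrightarrow> i < m \<Longrightarrow> linear (\<lambda>v. M (z(i := v)))"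
  unfolding multilinear_map_def by blast

lemma multilinear_map_fix_last:
  assumes "multilinear_map (Suc m) M"
  shows "multilinear_map m (\<lambda>z. M (z(m := b)))"
  unfolding multilinear_map_def
proof (intro conjI allI impI)
  fix z w :: "nat \<Rightarrow> 'a" assume "\<forall>i<m. z i = w i"
  then show "M (z(m := b)) = M (w(m := b))"
    by (intro multilinear_map_cong[OF assms]) (auto simp: less_Suc_eq)
next
  fix z :: "nat \<Rightarrow> 'a" and i assume "i < m"
  then have "(\<lambda>v. M ((z(i := v))(m := b))) = (\<lambda>v. M ((z(m := b))(i := v)))"
    by (simp add: fun_upd_twist)
  then show "linear (\<lambda>v. M ((z(i := v))(m := b)))"
    using multilinear_map_linear[OF assms, of i] \<open>i < m\<close> by simp
qed

text \<open>Induction on the number of slots rests on this: fixing the last slot at each basis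
  vector leaves finitely many maps of one argument fewer.\<close>

lemma multilinear_map_expand_last:
  fixes M :: "(nat \<Rightarrow> 'a::euclidean_space) \<Rightarrow> 'b::real_vector"
  assumes "multilinear_map (Suc m) M"
  shows "M z = (\<Sum>b\<in>Basis. (z m \<bullet> b) *\<^sub>R M (z(m := b)))"
proof -
  interpret linear "\<lambda>v. M (z(m := v))"
    by (rule multilinear_map_linear[OF assms]) simp
  have "M z = M (z(m := \<Sum>b\<in>Basis. (z m \<bullet> b) *\<^sub>R b))"
    by (simp add: euclidean_representation)
  also have "\<dots> = (\<Sum>b\<in>Basis. (z m \<bullet> b) *\<^sub>R M (z(m := b)))"
    by (simp add: sum scale)
  finally show ?thesis .
qed

text \<open>Leibniz rule. With the last slot expanded in the basis, the map is a sum of products of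
  a coordinate of \<open>g m\<close> with maps of \<open>m\<close> arguments, so the ordinary
  product rule and the induction hypothesis apply.\<close>

lemma has_derivative_multilinear_map:
  fixes M :: "(nat \<Rightarrow> 'a::euclidean_space) \<Rightarrow> 'b::real_normed_vector"
    and g :: "nat \<Rightarrow> 'c::real_normed_vector \<Rightarrow> 'a"
  assumes "multilinear_map m M" "\<And>i. i < m \<Longrightarrow> (g i has_derivative g' i) (at x)"
  shows "((\<lambda>y. M (\<lambda>i. g i y)) has_derivative
           (\<lambda>v. \<Sum>i<m. M ((\<lambda>j. g j x)(i := g' i v)))) (at x)"
  using assms
proof (induction m arbitrary: M)
  case 0
  \<comment> \<open>A map of no arguments is constant; \<open>undefined\<close> stands for an
    arbitrary tuple.\<close>
  have "(\<lambda>y. M (\<lambda>i. g i y)) = (\<lambda>y. M undefined)"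
    by (rule ext, rule multilinear_map_cong[OF 0(1)]) simp
  then show ?case by simp
next
  case (Suc m)
  let ?G = "\<lambda>y i. g i y"
  have lin: "linear (\<lambda>v. M ((?G x)(m := v)))"
    by (rule multilinear_map_linear[OF Suc.prems(1)]) simp
  have IH: "((\<lambda>y. M ((?G y)(m := b))) has_derivative
      (\<lambda>v. \<Sum>i<m. M (((?G x)(i := g' i v))(m := b)))) (at x)" for b
    using Suc.IH[OF multilinear_map_fix_last[OF Suc.prems(1), of b]] Suc.prems(2)
    by (simp add: fun_upd_def)
  have gm: "(g m has_derivative g' m) (at x)"
    using Suc.prems(2) by simp
  have eq: "(\<lambda>y. M (?G y)) = (\<lambda>y. \<Sum>b\<in>Basis. (g m y \<bullet> b) *\<^sub>R M ((?G y)(m := b)))"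
    using multilinear_map_expand_last[OF Suc.prems(1)] by fast
  have D: "((\<lambda>y. M (?G y)) has_derivative
      (\<lambda>v. \<Sum>b\<in>Basis. (g m x \<bullet> b) *\<^sub>R (\<Sum>i<m. M (((?G x)(i := g' i v))(m := b)))
         + (g' m v \<bullet> b) *\<^sub>R M ((?G x)(m := b)))) (at x)"
    unfolding eq
    by (intro has_derivative_sum has_derivative_scaleR IH has_derivative_inner_left gm)
  have "(\<Sum>b\<in>Basis. (g m x \<bullet> b) *\<^sub>R (\<Sum>i<m. M (((?G x)(i := g' i v))(m := b)))
         + (g' m v \<bullet> b) *\<^sub>R M ((?G x)(m := b))) = (\<Sum>i<Suc m. M ((?G x)(i := g' i v)))" for v
  proof -
    \<comment> \<open>For \<open>i < m\<close> the update at \<open>i\<close> leaves slot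
      \<open>m\<close> alone, so the basis expansion of slot \<open>m\<close> can be folded back
      term by term.\<close>
    have "(\<Sum>b\<in>Basis. (g m x \<bullet> b) *\<^sub>R (\<Sum>i<m. M (((?G x)(i := g' i v))(m := b))))
        = (\<Sum>i<m. \<Sum>b\<in>Basis. (((?G x)(i := g' i v)) m \<bullet> b) *\<^sub>R M (((?G x)(i := g' i v))(m := b)))"
      by (subst sum.swap) (auto simp: scaleR_sum_right intro!: sum.cong)
    also have "\<dots> = (\<Sum>i<m. M ((?G x)(i := g' i v)))"
      by (simp only: multilinear_map_expand_last[OF Suc.prems(1), symmetric])
    finally have 1: "(\<Sum>b\<in>Basis. (g m x \<bullet> b) *\<^sub>R (\<Sum>i<m. M (((?G x)(i := g' i v))(m := b))))
        = (\<Sum>i<m. M ((?G x)(i := g' i v)))" .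
    have 2: "(\<Sum>b\<in>Basis. (g' m v \<bullet> b) *\<^sub>R M ((?G x)(m := b))) = M ((?G x)(m := g' m v))"
      using multilinear_map_expand_last[OF Suc.prems(1), of "(?G x)(m := g' m v)"]
      by (simp only: fun_upd_upd fun_upd_same)
    show ?thesis by (simp only: sum.distrib 1 2 sum.lessThan_Suc)
  qed
  with D show ?case by (simp only:)
qed

lemma real_polynomial_function_multilinear_map:
  fixes M :: "(nat \<Rightarrow> 'a::euclidean_space) \<Rightarrow> real"
    and g :: "nat \<Rightarrow> 'c::real_normed_vector \<Rightarrow> 'a"
  assumes "multilinear_map m M" "\<And>i. i < m \<Longrightarrow> polynomial_function (g i)"
  shows "real_polynomial_function (\<lambda>y. M (\<lambda>i. g i y))"
  using assms
proof (induction m arbitrary: M)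
  case 0
  have "(\<lambda>y. M (\<lambda>i. g i y)) = (\<lambda>y. M undefined)"
    by (rule ext, rule multilinear_map_cong[OF 0(1)]) simp
  then show ?case by (auto intro: real_polynomial_function.intros)
next
  case (Suc m)
  have eq: "(\<lambda>y. M (\<lambda>i. g i y))
      = (\<lambda>y. \<Sum>b\<in>Basis. (g m y \<bullet> b) * M ((\<lambda>i. g i y)(m := b)))"
    by (rule ext, subst multilinear_map_expand_last[OF Suc.prems(1)]) simp
  have "real_polynomial_function (\<lambda>y. M ((\<lambda>i. g i y)(m := b)))" for b
    using Suc.IH[OF multilinear_map_fix_last[OF Suc.prems(1), of b]] Suc.prems(2)
    by (simp add: fun_upd_def)
  moreover have "real_polynomial_function (\<lambda>y. g m y \<bullet> b)" if "b \<in> Basis" for b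
    using Suc.prems(2)[of m] that by (simp add: polynomial_function_iff_Basis_inner)
  ultimately show ?case
    unfolding eq
    by (intro real_polynomial_function_sum real_polynomial_function.intros(4)) auto
qed

lemma symmetric_map_swap:
  assumes "symmetric_map m M" "i < m" "j < m"
  shows "M (z \<circ> Transposition.transpose i j) = M z"
  using assms permutes_swap_id[of i "{..<m}" j] unfolding symmetric_map_def by blast

text \<open>
  Polarization, one slot at a time: if \<open>G\<close> vanishes whenever all slots from \<open>j\<close> on agree,
  differentiating in the common value gives the same for \<open>Suc j\<close>, since by symmetry the
  \<open>m - j\<close> terms of the product rule coincide.
\<close>

lemma multilinear_symmetric_eq_0:
  fixes G :: "(nat \<Rightarrow> 'a::euclidean_space) \<Rightarrow> 'b::real_normed_vector"
  assumes ml: "multilinear_map m G" and sym: "symmetric_map m G"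
    and diag: "\<And>x. G (\<lambda>_. x) = 0"
  shows "G z = 0"
proof -
  have "j \<le> m \<Longrightarrow> G (\<lambda>i. if i < j then z i else x) = 0" for j z x
  proof (induction j arbitrary: z x)
    case 0
    then show ?case using diag by simp
  next
    case (Suc j)
    define v where "v = z j"
    \<comment> \<open>The first \<open>j\<close> slots are frozen at \<open>z\<close>, the others
      share the variable \<open>y\<close>; \<open>g'\<close> is the derivative of these
      slots.\<close>
    define g where "g i y = (if i < j then z i else y)" for i and y :: 'a
    define g' where "g' i u = (if i < j then 0 else u)" for i and u :: 'a
    have "((\<lambda>y. G (\<lambda>i. g i y)) has_derivative
             (\<lambda>u. \<Sum>i<m. G ((\<lambda>l. g l x)(i := g' i u)))) (at x)"
    proof (rule has_derivative_multilinear_map[OF ml])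
      show "(g i has_derivative g' i) (at x)" for i
      proof -
        have "g i = (if i < j then (\<lambda>_. z i) else (\<lambda>y. y))"
          "g' i = (if i < j then (\<lambda>_. 0) else (\<lambda>y. y))"
          by (simp_all add: g_def g'_def fun_eq_iff)
        then show ?thesis by simp
      qed
    qed
    moreover have "(\<lambda>y. G (\<lambda>i. g i y)) = (\<lambda>_. 0)"
      using Suc.IH[of z] Suc.prems by (simp add: g_def)
    ultimately have "((\<lambda>_. 0) has_derivative
        (\<lambda>u. \<Sum>i<m. G ((\<lambda>l. g l x)(i := g' i u)))) (at x)"
      by simp
    from has_derivative_unique[OF this has_derivative_const]
    have "(\<Sum>i<m. G ((\<lambda>l. g l x)(i := g' i v))) = 0"
      by (rule fun_cong)
    moreover have "(\<Sum>i<m. G ((\<lambda>l. g l x)(i := g' i v)))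
        = (\<Sum>i<m. if j \<le> i then G ((\<lambda>l. g l x)(j := v)) else 0)"
    proof (rule sum.cong[OF refl])
      fix i assume i: "i \<in> {..<m}"
      show "G ((\<lambda>l. g l x)(i := g' i v)) = (if j \<le> i then G ((\<lambda>l. g l x)(j := v)) else 0)"
      proof (cases "j \<le> i")
        \<comment> \<open>Slots \<open>i\<close> and \<open>j\<close> both carry \<open>x\<close>,
          so a transposition moves the inserted \<open>v\<close> from slot \<open>i\<close> to slot
          \<open>j\<close>.\<close>
        case True
        then have "(\<lambda>l. g l x)(i := g' i v) = (\<lambda>l. g l x)(j := v) \<circ> Transposition.transpose i j"
          by (auto simp: g_def g'_def Transposition.transpose_def fun_eq_iff)
        then show ?thesis
          using True symmetric_map_swap[OF sym, of i j] i by simp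
      next
        case False
        have "linear (\<lambda>u. G ((\<lambda>l. g l x)(i := u)))"
          using multilinear_map_linear[OF ml] i by blast
        from linear_0[OF this] show ?thesis
          using False by (simp add: g'_def)
      qed
    qed
    moreover have "\<dots> = real (m - j) *\<^sub>R G ((\<lambda>l. g l x)(j := v))"
    proof -
      have "{..<m} \<inter> {i. j \<le> i} = {j..<m}" by auto
      then show ?thesis by (simp add: sum.If_cases sum_constant_scaleR del: sum_constant)
    qed
    ultimately have "G ((\<lambda>l. g l x)(j := v)) = 0"
      using Suc.prems by simp
    moreover have "(\<lambda>l. g l x)(j := v) = (\<lambda>i. if i < Suc j then z i else x)"
      by (auto simp: g_def v_def fun_eq_iff less_Suc_eq)
    ultimately show ?case by simp
  qed
  \<comment> \<open>At \<open>j = m\<close> every relevant slot is prescribed, and the common tail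
    value is irrelevant.\<close>
  from this[of m z undefined] show ?thesis
    using multilinear_map_cong[OF ml, of z "\<lambda>i. if i < m then z i else undefined"] by simp
qed

text \<open>Uniqueness behind the definite description: the difference of two candidates is
  multilinear and symmetric and vanishes on the diagonal, hence is zero.\<close>

lemma polarization_eqI:
  fixes f :: "'a::euclidean_space \<Rightarrow> 'b::real_normed_vector"
  assumes ml: "multilinear_map m F" and sym: "symmetric_map m F" and diag: "\<And>x. F (\<lambda>_. x) = f x"
  shows "polarization m f = F"
  unfolding polarization_def
proof (rule the_equality)
  show "multilinear_map m F \<and> symmetric_map m F \<and> (\<forall>x. F (\<lambda>_. x) = f x)"
    using assms by blast
next
  fix G assume G: "multilinear_map m G \<and> symmetric_map m G \<and> (\<forall>x. G (\<lambda>_. x) = f x)"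
  have "multilinear_map m (\<lambda>z. G z - F z)"
    unfolding multilinear_map_def
  proof (intro conjI allI impI)
    fix z w :: "nat \<Rightarrow> 'a" assume "\<forall>i<m. z i = w i"
    then show "G z - F z = G w - F w"
      using G ml unfolding multilinear_map_def by metis
  next
    fix z :: "nat \<Rightarrow> 'a" and i assume "i < m"
    then show "linear (\<lambda>v. G (z(i := v)) - F (z(i := v)))"
      using G ml by (intro linear_compose_sub multilinear_map_linear) auto
  qed
  moreover have "symmetric_map m (\<lambda>z. G z - F z)"
    using G sym unfolding symmetric_map_def by simp
  ultimately have "G z - F z = 0" for z
    by (rule multilinear_symmetric_eq_0) (use G diag in simp)
  then show "G = F"
    by (simp add: fun_eq_iff)
qed

section \<open>Contraction of the tensor and the gradient of the Hamiltonian\<close>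

lemma column_vector_inner:
  assumes "linear l"
  shows "column_vector l \<bullet> v = l v"
proof -
  have "\<exists>!w. \<forall>v. w \<bullet> v = l v"
  proof (rule ex_ex1I)
    show "\<exists>w. \<forall>v. w \<bullet> v = l v"
      \<comment> \<open>The Riesz representative of a functional is its adjoint applied to
        1.\<close>
      by (rule exI[of _ "adjoint l 1"]) (metis adjoint_works assms inner_real_def mult_1 inner_commute)
  qed (metis vector_eq_rdot)
  from theI'[OF this] show ?thesis
    unfolding column_vector_def by blast
qed

lemma contract_inner:
  assumes "multilinear_map (k + 2) T"
  shows "contract k T z \<bullet> v = T (z(Suc k := v))"
  unfolding contract_def
  by (rule column_vector_inner, rule multilinear_map_linear[OF assms]) simp

lemma multilinear_map_contract:
  assumes "multilinear_map (k + 2) T"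
  shows "multilinear_map (Suc k) (contract k T)"
  unfolding multilinear_map_def
proof (intro conjI allI impI)
  fix z w :: "nat \<Rightarrow> real ^ 'a" assume "\<forall>i<Suc k. z i = w i"
  then have "T (z(Suc k := v)) = T (w(Suc k := v))" for v
    by (intro multilinear_map_cong[OF assms]) (auto simp: less_Suc_eq)
  then show "contract k T z = contract k T w"
    unfolding contract_def by simp
next
  fix z :: "nat \<Rightarrow> real ^ 'a" and i assume i: "i < Suc k"
  have *: "(z(i := v))(Suc k := u) = (z(Suc k := u))(i := v)" for u v
    using i by (auto simp: fun_eq_iff)
  have lin: "linear (\<lambda>v. T ((z(Suc k := u))(i := v)))" for u
    using i by (intro multilinear_map_linear[OF assms]) auto
  show "linear (\<lambda>v. contract k T (z(i := v)))"
    by (rule linearI; rule vector_eq_rdot[THEN iffD1])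
      (simp_all add: inner_add_left contract_inner[OF assms] * linear_add[OF lin] linear_cmul[OF lin])
qed

lemma symmetric_map_contract:
  assumes "symmetric_map (k + 2) T"
  shows "symmetric_map (Suc k) (contract k T)"
  unfolding symmetric_map_def
proof (intro allI impI)
  fix p and z :: "nat \<Rightarrow> real ^ 'a" assume p: "p permutes {..<Suc k}"
  then have p': "p permutes {..<k + 2}"
    by (rule permutes_subset) auto
  \<comment> \<open>The permutation fixes the contracted slot, so inserting \<open>v\<close> there
    commutes with permuting.\<close>
  have "p (Suc k) = Suc k"
    by (rule permutes_not_in[OF p]) simp
  then have "p i = Suc k \<longleftrightarrow> i = Suc k" for i
    using inj_eq[OF permutes_inj[OF p], of i "Suc k"] by simp
  then have "(z \<circ> p)(Suc k := v) = z(Suc k := v) \<circ> p" for v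
    by (auto simp: fun_eq_iff)
  then show "contract k T (z \<circ> p) = contract k T z"
    using assms p' unfolding contract_def symmetric_map_def by simp
qed

lemma multilinear_map_compose_linear:
  assumes "multilinear_map m M" "linear g"
  shows "multilinear_map m (\<lambda>z. g (M z))"
  unfolding multilinear_map_def
proof (intro conjI allI impI)
  fix z w :: "nat \<Rightarrow> 'a" assume "\<forall>i<m. z i = w i"
  then show "g (M z) = g (M w)" using multilinear_map_cong[OF assms(1)] by metis
next
  fix z :: "nat \<Rightarrow> 'a" and i assume "i < m"
  from linear_compose[OF multilinear_map_linear[OF assms(1) this] assms(2)]
  show "linear (\<lambda>v. g (M (z(i := v))))" by (simp add: o_def)
qed

text \<open>By symmetry the \<open>k + 2\<close> Leibniz terms on the diagonal coincide, and this
  factor turns \<open>1 / fact (k + 2)\<close> into \<open>1 / fact (k + 1)\<close>.\<close>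

lemma gradient_homogeneous:
  assumes ml: "multilinear_map (k + 2) T" and sym: "symmetric_map (k + 2) T"
    and H: "\<And>x. H x = T (\<lambda>_. x) / fact (k + 2)"
  shows "gradient H x = (1 / fact (k + 1)) *\<^sub>R contract k T (\<lambda>_. x)"
proof -
  let ?D = "(1 / fact (k + 1)) *\<^sub>R contract k T (\<lambda>_. x)"
  have "((\<lambda>y. T (\<lambda>_. y)) has_derivative (\<lambda>v. \<Sum>i<k + 2. T ((\<lambda>_. x)(i := v)))) (at x)"
    by (rule has_derivative_multilinear_map[OF ml]) auto
  then have "((\<lambda>y. T (\<lambda>_. y) / fact (k + 2)) has_derivative
      (\<lambda>v. (\<Sum>i<k + 2. T ((\<lambda>_. x)(i := v))) / fact (k + 2))) (at x)"
    by (rule bounded_linear.has_derivative[OF bounded_linear_divide])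
  moreover have "(\<Sum>i<k + 2. T ((\<lambda>_. x)(i := v))) / fact (k + 2) = v \<bullet> ?D" for v
  proof -
    have swap: "T ((\<lambda>_. x)(i := v)) = T ((\<lambda>_. x)(Suc k := v))" if "i < k + 2" for i
    proof -
      have "(\<lambda>_. x)(i := v) = (\<lambda>_. x)(Suc k := v) \<circ> Transposition.transpose i (Suc k)"
        by (auto simp: fun_eq_iff Transposition.transpose_def)
      then show ?thesis using symmetric_map_swap[OF sym that, of "Suc k"] by simp
    qed
    have "(\<Sum>i<k + 2. T ((\<lambda>_. x)(i := v))) = (\<Sum>i<k + 2. T ((\<lambda>_. x)(Suc k := v)))"
      by (intro sum.cong refl swap) (simp only: lessThan_iff)
    then have "(\<Sum>i<k + 2. T ((\<lambda>_. x)(i := v))) = real (k + 2) * T ((\<lambda>_. x)(Suc k := v))"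
      by simp
    moreover have "v \<bullet> ?D = T ((\<lambda>_. x)(Suc k := v)) / fact (k + 1)"
      by (simp add: inner_commute[of v] contract_inner[OF ml])
    moreover have "(fact (k + 2) :: real) = real (k + 2) * fact (k + 1)"
      using fact_Suc[of "k + 1", where 'a = real] by simp
    moreover have "real (k + 2) \<noteq> 0"
      by simp
    ultimately show ?thesis
      by (simp only: mult_divide_mult_cancel_left_if if_False)
  qed
  ultimately have "GDERIV H x :> ?D"
    unfolding gderiv_def H by simp
  moreover have "D = ?D" if "GDERIV H x :> D" for D
  proof -
    have "(\<lambda>v. v \<bullet> D) = (\<lambda>v. v \<bullet> ?D)"
      by (rule has_derivative_unique; fact that[unfolded gderiv_def]
            \<open>GDERIV H x :> ?D\<close>[unfolded gderiv_def])
    then have "\<forall>v. v \<bullet> D = v \<bullet> ?D"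
      by (intro allI) (rule fun_cong)
    then show ?thesis
      by (rule vector_eq_ldot[THEN iffD1])
  qed
  ultimately show ?thesis
    unfolding gradient_def by (rule the_equality)
qed

section \<open>Polynomial functions\<close>

lemma open_real_polynomial_nonzero:
  assumes "real_polynomial_function P"
  shows "open {x. P x \<noteq> 0}"
proof -
  have "{x. P x \<noteq> 0} = P -` (- {0})" by auto
  then show ?thesis
    using assms by (auto simp: real_polynomial_function_eq
        intro!: open_vimage continuous_on_polymonial_function)
qed

text \<open>
  On the line through a given point and a point where \<open>P\<close> does not vanish, \<open>P\<close> is a nonzero
  univariate polynomial and so has only finitely many zeros.
\<close>

lemma closure_real_polynomial_nonzero:
  fixes P :: "'a::real_normed_vector \<Rightarrow> real"
  assumes P: "real_polynomial_function P" and p: "P p \<noteq> 0"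
  shows "closure {x. P x \<noteq> 0} = UNIV"
proof -
  have "x \<in> closure {x. P x \<noteq> 0}" for x
    unfolding closure_approachable
  proof (intro allI impI)
    fix r :: real assume r: "0 < r"
    define g where "g t = x + t *\<^sub>R (p - x)" for t :: real
    have "polynomial_function g"
      unfolding g_def
      by (intro polynomial_function_add polynomial_function_bounded_linear
          polynomial_function_const bounded_linear_scaleR_left)
    from real_polynomial_function_imp_sum[OF real_polynomial_function_compose[OF this P]]
    obtain a n where an: "P (g t) = (\<Sum>i\<le>n. a i * t ^ i)" for t
      by (auto simp: o_def fun_eq_iff)
    have "P (g 1) \<noteq> 0" using p by (simp add: g_def)
    then have "\<exists>i\<le>n. a i \<noteq> 0"
      unfolding an by (metis (no_types, lifting) mult_zero_left sum.neutral atMost_iff)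
    then have "finite {t. P (g t) = 0}"
      unfolding an by (simp add: polyfun_finite_roots)
    moreover have "\<forall>\<^sub>F t in at_right 0. dist (g t) x < r"
    proof -
      have "(g \<longlongrightarrow> g 0) (at_right 0)"
        unfolding g_def by (intro tendsto_intros)
      from tendstoD[OF this r] show ?thesis by (simp add: g_def)
    qed
    then obtain b where b: "0 < b" "\<And>t. 0 < t \<Longrightarrow> t < b \<Longrightarrow> dist (g t) x < r"
      by (auto simp: eventually_at_right_field)
    \<comment> \<open>Infinitely many parameters give points close to \<open>x\<close>, so one of
      them avoids the finitely many roots.\<close>
    moreover have "infinite {0<..<b}" using b by simp
    ultimately have "\<not> {0<..<b} \<subseteq> {t. P (g t) = 0}"
      using finite_subset by blast
    then show "\<exists>y\<in>{x. P x \<noteq> 0}. dist y x < r"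
      using b by auto
  qed
  then show ?thesis by blast
qed

text \<open>A nonempty open set meets a dense one; this combines nonvanishing witnesses found at
  different points.\<close>

lemma real_polynomial_mult_nonzero:
  fixes P Q :: "'a::real_normed_vector \<Rightarrow> real"
  assumes P: "real_polynomial_function P" "P p \<noteq> 0"
    and Q: "real_polynomial_function Q" "Q q \<noteq> 0"
  obtains x where "P x * Q x \<noteq> 0"
proof -
  have "p \<in> closure {x. Q x \<noteq> 0}"
    using closure_real_polynomial_nonzero[OF Q] by simp
  with open_real_polynomial_nonzero[OF P(1)] P(2) have "{x. P x \<noteq> 0} \<inter> {x. Q x \<noteq> 0} \<noteq> {}"
    unfolding closure_iff_nhds_not_empty by blast
  then show ?thesis using that by auto
qed

text \<open>The direction may itself vary polynomially with the point. This is what makes the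
  derivative along the field \<open>direction p\<close> below a polynomial.\<close>

lemma real_polynomial_function_derivative:
  fixes P :: "'a::real_normed_vector \<Rightarrow> real"
  assumes "real_polynomial_function P"
  obtains P' where "\<And>x. (P has_derivative P' x) (at x)"
    "\<And>w. polynomial_function w \<Longrightarrow> real_polynomial_function (\<lambda>x. P' x (w x))"
proof -
  have "\<exists>P'. (\<forall>x. (P has_derivative P' x) (at x)) \<and>
      (\<forall>w. polynomial_function w \<longrightarrow> real_polynomial_function (\<lambda>x. P' x (w x)))"
    using assms
  proof induction
    case (linear f)
    then show ?case
      by (intro exI[of _ "\<lambda>_. f"])
        (auto intro: bounded_linear_imp_has_derivative simp: polynomial_function_def o_def)
  next
    case (const c)
    then show ?case by (intro exI[of _ "\<lambda>_ _. 0"]) auto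
  next
    case (add f g)
    then obtain f' g' where
      f': "\<And>x. (f has_derivative f' x) (at x)" "\<And>w. polynomial_function w \<Longrightarrow> real_polynomial_function (\<lambda>x. f' x (w x))"
      and g': "\<And>x. (g has_derivative g' x) (at x)" "\<And>w. polynomial_function w \<Longrightarrow> real_polynomial_function (\<lambda>x. g' x (w x))"
      by blast
    then show ?case
      by (intro exI[of _ "\<lambda>x v. f' x v + g' x v"]) (auto intro!: has_derivative_add)
  next
    case (mult f g)
    then obtain f' g' where
      f': "\<And>x. (f has_derivative f' x) (at x)" "\<And>w. polynomial_function w \<Longrightarrow> real_polynomial_function (\<lambda>x. f' x (w x))"
      and g': "\<And>x. (g has_derivative g' x) (at x)" "\<And>w. polynomial_function w \<Longrightarrow> real_polynomial_function (\<lambda>x. g' x (w x))"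
      by blast
    then show ?case
      using mult.hyps
      by (intro exI[of _ "\<lambda>x v. f x * g' x v + f' x v * g x"])
        (auto intro!: has_derivative_mult real_polynomial_function.intros(3,4))
  qed
  then show ?thesis using that by blast
qed

lemma real_polynomial_function_inner:
  fixes f g :: "'a::real_normed_vector \<Rightarrow> 'b::euclidean_space"
  assumes "polynomial_function f" "polynomial_function g"
  shows "real_polynomial_function (\<lambda>x. f x \<bullet> g x)"
proof -
  have "real_polynomial_function (\<lambda>x. \<Sum>b\<in>Basis. (f x \<bullet> b) * (g x \<bullet> b))"
    using assms unfolding polynomial_function_iff_Basis_inner
    by (intro real_polynomial_function_sum real_polynomial_function.intros(4)) auto
  then show ?thesis by (simp only: euclidean_inner[symmetric])
qed

lemma polynomial_function_linear_compose:
  fixes f :: "'a::real_normed_vector \<Rightarrow> 'b::euclidean_space" and g :: "'b \<Rightarrow> 'c::real_normed_vector"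
  assumes "linear g" "polynomial_function f"
  shows "polynomial_function (\<lambda>x. g (f x))"
  using polynomial_function_compose[OF assms(2) polynomial_function_bounded_linear[
      OF assms(1)[unfolded linear_conv_bounded_linear]]]
  by (simp add: o_def)

lemma polynomial_function_vec_nth:
  fixes f :: "'a::real_normed_vector \<Rightarrow> 'b::euclidean_space ^ 'n"
  assumes "polynomial_function f"
  shows "polynomial_function (\<lambda>x. f x $ i)"
  by (rule polynomial_function_linear_compose[OF _ assms])
    (simp add: bounded_linear.linear bounded_linear_vec_nth)

lemma real_polynomial_function_nth:
  assumes "polynomial_function f"
  shows "real_polynomial_function (\<lambda>x. f x $ i :: real)"
  using polynomial_function_vec_nth[OF assms] by (simp add: real_polynomial_function_eq)

lemma polynomial_function_vecI:
  fixes f :: "'a::real_normed_vector \<Rightarrow> 'b::euclidean_space ^ 'n"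
  assumes "\<And>i. polynomial_function (\<lambda>x. f x $ i)"
  shows "polynomial_function f"
  unfolding polynomial_function_iff_Basis_inner
  using assms
  by (auto simp: Basis_vec_def inner_axis polynomial_function_iff_Basis_inner)

lemma real_polynomial_function_det:
  fixes A :: "'a::real_normed_vector \<Rightarrow> real ^ 'n ^ 'n"
  assumes "\<And>i j. real_polynomial_function (\<lambda>x. A x $ i $ j)"
  shows "real_polynomial_function (\<lambda>x. det (A x))"
  unfolding det_def
  using assms
  by (intro real_polynomial_function_sum real_polynomial_function_prod
      real_polynomial_function.intros(2,4)) (auto simp: finite_permutations)

section \<open>The polar recurrence\<close>

lemma partial_iterate_Suc:
  "partial_iterate (Suc m) \<phi> x = Some y \<longleftrightarrow>
     (\<exists>y'. partial_iterate m \<phi> x = Some y' \<and> \<phi> y' = Some y)"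
  by (auto simp: partial_iterate_def map_comp_def split: option.splits)

lemma next_point_SomeD:
  assumes "next_point e k E x = Some v"
  shows "E (extend e k x v)" "E (extend e k x u) \<Longrightarrow> u = v"
proof -
  have ex: "\<exists>!v. E (extend e k x v)" and v: "v = (THE v. E (extend e k x v))"
    using assms by (auto simp: next_point_def split: if_splits)
  show "E (extend e k x v)" unfolding v by (rule theI'[OF ex])
  then show "E (extend e k x u) \<Longrightarrow> u = v" using ex by blast
qed

lemma next_point_eq_Some:
  assumes "\<And>u. E (extend e k x u) \<longleftrightarrow> u = v"
  shows "next_point e k E x = Some v"
  unfolding next_point_def assms by simp

text \<open>Each step appends one entry, so \<open>m\<close> steps unfold into one sequence whose
  windows at \<open>0\<close> and \<open>m\<close> are \<open>x\<close> and \<open>y\<close>. The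
  congruence assumption says that \<open>E\<close> sees only the entries up to index
  \<open>k\<close>.\<close>

lemma step_map_iterate_orbit:
  assumes e: "bij_betw e {..<k} UNIV"
    and E_cong: "\<And>z w. (\<And>i. i \<le> k \<Longrightarrow> z i = w i) \<Longrightarrow> E z \<Longrightarrow> E w"
    and "partial_iterate m (step_map e k E) x = Some y"
  shows "\<exists>z. (\<forall>i<k. z i = x $ e i) \<and> (\<forall>i<k. z (m + i) = y $ e i) \<and> (\<forall>j<m. E (\<lambda>i. z (j + i)))"
  using assms(3)
proof (induction m arbitrary: y)
  case 0
  have "inv_into {..<k} e (e i) = i" if "i < k" for i
    using bij_betw_inv_into_left[OF e] that by simp
  moreover have "y = x" using 0 by (simp add: partial_iterate_def)
  ultimately show ?case
    by (intro exI[of _ "\<lambda>i. x $ e i"]) simp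
next
  case (Suc m)
  then obtain y' where y': "partial_iterate m (step_map e k E) x = Some y'"
    "step_map e k E y' = Some y"
    by (auto simp: partial_iterate_Suc)
  from Suc.IH[OF y'(1)] obtain z where z: "\<And>i. i < k \<Longrightarrow> z i = x $ e i"
    "\<And>i. i < k \<Longrightarrow> z (m + i) = y' $ e i" "\<And>j. j < m \<Longrightarrow> E (\<lambda>i. z (j + i))"
    by blast
  from y'(2) obtain v where v: "next_point e k E y' = Some v"
    "y = (\<chi> j. extend e k y' v (Suc (inv_into {..<k} e j)))"
    by (auto simp: step_map_def)
  have ye: "y $ e i = extend e k y' v (Suc i)" if "i < k" for i
    using that bij_betw_inv_into_left[OF e] by (simp add: v(2))
  \<comment> \<open>The new entry lies beyond all earlier windows, whose indices end at
    \<open>j + k\<close> with \<open>j < m\<close>.\<close>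
  let ?z = "z(m + k := v)"
  have "E (\<lambda>i. ?z (j + i))" if "j < Suc m" for j
  proof (cases "j = m")
    case True
    show ?thesis
      by (rule E_cong[OF _ next_point_SomeD(1)[OF v(1)]])
        (auto simp: extend_def True z(2))
  next
    case False
    then have "j < m" using that by simp
    then show ?thesis
      by (intro E_cong[OF _ z(3)[OF \<open>j < m\<close>]]) auto
  qed
  moreover have "?z (Suc m + i) = y $ e i" if "i < k" for i
    using that z(2)[of "Suc i"] by (auto simp: ye extend_def)
  ultimately show ?case
    using z(1) by (intro exI[of _ ?z]) auto
qed

section \<open>Algebra of the symplectic form\<close>

lemma symplectic_form_add_right:
  "symplectic_form \<Omega> u (v + w) = symplectic_form \<Omega> u v + symplectic_form \<Omega> u w"
  by (simp add: symplectic_form_def matrix_vector_right_distrib inner_add_right)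

lemma symplectic_form_diff_right:
  "symplectic_form \<Omega> u (v - w) = symplectic_form \<Omega> u v - symplectic_form \<Omega> u w"
  by (simp add: symplectic_form_def matrix_vector_mult_diff_distrib inner_diff_right)

lemma symplectic_form_scale_left:
  "symplectic_form \<Omega> (r *\<^sub>R u) v = r * symplectic_form \<Omega> u v"
  by (simp add: symplectic_form_def)

lemma symplectic_form_scale_right:
  "symplectic_form \<Omega> u (r *\<^sub>R v) = r * symplectic_form \<Omega> u v"
  by (simp add: symplectic_form_def matrix_vector_mult_scaleR)

lemma bounded_bilinear_symplectic_form: "bounded_bilinear (symplectic_form \<Omega>)"
  using bounded_bilinear.comp[OF bounded_bilinear_inner bounded_linear_ident
      matrix_vector_mul_bounded_linear[of \<Omega>]]
  by (simp add: symplectic_form_def[abs_def])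

lemma real_polynomial_function_symplectic_form:
  assumes "polynomial_function f" "polynomial_function g"
  shows "real_polynomial_function (\<lambda>x. symplectic_form \<Omega> (f x) (g x))"
  unfolding symplectic_form_def
  by (intro real_polynomial_function_inner assms
      polynomial_function_linear_compose[OF matrix_vector_mul_linear assms(2)])

section \<open>The recurrence of a symmetric tensor and its invariants\<close>

locale polar_recurrence =
  fixes k :: nat
    and e :: "nat \<Rightarrow> 'k::finite"
    and T :: "(nat \<Rightarrow> real ^ 'n) \<Rightarrow> real"
    and \<Omega> :: "real ^ 'n ^ 'n"
    and h :: real
  assumes k: "k \<ge> 1"
    and e: "bij_betw e {..<k} UNIV"
    and T_ml: "multilinear_map (k + 2) T"
    and T_sym: "symmetric_map (k + 2) T"
    and \<Omega>_inv: "invertible \<Omega>"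
    and \<Omega>_skew: "transpose \<Omega> = - \<Omega>"
    and h: "h \<noteq> 0"
begin

text \<open>The scalar that remains on the right once the polar equation is multiplied by
  \<open>real k * h\<close>.\<close>

definition c :: real where
  "c = real k * h / fact (k + 1)"

definition increment :: "(nat \<Rightarrow> real ^ 'n) \<Rightarrow> real ^ 'n" where
  "increment z = c *\<^sub>R (matrix_inv \<Omega> *v contract k T z)"

definition recurrence :: "(nat \<Rightarrow> real ^ 'n) \<Rightarrow> bool" where
  "recurrence z \<longleftrightarrow> z k - z 0 = increment z"

abbreviation \<omega> :: "real ^ 'n \<Rightarrow> real ^ 'n \<Rightarrow> real" where
  "\<omega> \<equiv> symplectic_form \<Omega>"

lemma c_nonzero: "c \<noteq> 0"
  using k h by (simp add: c_def)

lemma recurrence_iff: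
  "recurrence z \<longleftrightarrow>
     (z k - z 0) /\<^sub>R (real k * h) = (1 / fact (k + 1)) *\<^sub>R (matrix_inv \<Omega> *v contract k T z)"
proof -
  have kh: "real k * h \<noteq> 0" using k h by simp
  have "increment z = (real k * h) *\<^sub>R ((1 / fact (k + 1)) *\<^sub>R (matrix_inv \<Omega> *v contract k T z))"
    by (simp add: increment_def c_def)
  then show ?thesis
    unfolding recurrence_def
    by (metis kh divideR_right)
qed

lemma matrix_inv_\<Omega>: "\<Omega> *v (matrix_inv \<Omega> *v v) = v"
proof -
  have "\<Omega> ** matrix_inv \<Omega> = mat 1"
    using \<Omega>_inv unfolding invertible_def matrix_inv_def by (metis (mono_tags, lifting) someI_ex)
  then show ?thesis by (simp add: matrix_vector_mul_assoc)
qed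

lemma \<Omega>_mult_nonzero: "v \<noteq> 0 \<Longrightarrow> \<Omega> *v v \<noteq> 0"
  using \<Omega>_inv by (metis invertible_def matrix_vector_mul_assoc matrix_vector_mul_lid matrix_vector_mult_0_right)

lemma \<omega>_skew: "\<omega> u v = - \<omega> v u"
proof -
  have "\<omega> u v = (transpose \<Omega> *v u) \<bullet> v"
    by (simp add: symplectic_form_def dot_lmul_matrix[symmetric] transpose_matrix_vector)
  also have "\<dots> = - \<omega> v u"
    using matrix_vector_mult_diff_rdistrib[of 0 \<Omega> u]
    by (simp add: \<Omega>_skew symplectic_form_def inner_commute)
  finally show ?thesis .
qed

lemma \<omega>_self: "\<omega> u u = 0"
  using \<omega>_skew[of u u] by simp

text \<open>Here \<open>\<Omega>\<close> cancels its inverse, so pairing with \<open>u\<close>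
  simply fills the free slot of the tensor.\<close>

lemma \<omega>_increment: "\<omega> u (increment z) = c * T (z(Suc k := u))"
  unfolding increment_def symplectic_form_scale_right
  by (simp add: symplectic_form_def matrix_inv_\<Omega> inner_commute[of u] contract_inner[OF T_ml])

lemma multilinear_map_increment: "multilinear_map (Suc k) increment"
proof -
  have "linear (\<lambda>w. c *\<^sub>R (matrix_inv \<Omega> *v w))"
    by (intro linear_compose_scale_right matrix_vector_mul_linear)
  from multilinear_map_compose_linear[OF multilinear_map_contract[OF T_ml] this]
  show ?thesis by (simp add: increment_def[abs_def])
qed

lemma recurrence_cong:
  assumes "\<And>i. i \<le> k \<Longrightarrow> z i = w i" and "recurrence z"
  shows "recurrence w"
proof -
  have "increment z = increment w"
    using assms(1) by (intro multilinear_map_cong[OF multilinear_map_increment]) auto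
  then show ?thesis using assms unfolding recurrence_def by simp
qed

text \<open>
  Pairing the equation at \<open>z\<close> with \<open>z\<^bsub>k+1\<^esub>\<close> and the shifted equation with \<open>z\<^sub>0\<close> gives the same
  value \<open>c T(z\<^sub>0, \<dots>, z\<^bsub>k+1\<^esub>)\<close>, by symmetry of \<open>T\<close>; the terms \<open>\<omega>(z\<^sub>0, z\<^bsub>k+1\<^esub>)\<close> cancel.
\<close>

lemma pairing_shift:
  assumes E0: "recurrence z" and E1: "recurrence (\<lambda>i. z (Suc i))"
  shows "\<omega> (z k) (z (Suc k)) = \<omega> (z 0) (z 1)"
proof -
  \<comment> \<open>The cyclic rotation that brings \<open>z 0\<close> to the last slot of the
    tensor.\<close>
  define p where "p i = (if i < Suc k then Suc i else if i = Suc k then 0 else i)" for i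
  have p: "p permutes {..<k + 2}"
    unfolding permutes_def
  proof (intro conjI allI impI)
    show "p i = i" if "i \<notin> {..<k + 2}" for i
      using that by (auto simp: p_def)
    show "\<exists>!i. p i = j" for j
    proof (intro ex_ex1I)
      show "\<exists>i. p i = j"
      proof (cases "j = 0")
        case True
        then show ?thesis by (intro exI[of _ "Suc k"]) (simp add: p_def)
      next
        case False
        show ?thesis
        proof (cases "j \<le> Suc k")
          case True
          then show ?thesis using False by (intro exI[of _ "j - 1"]) (auto simp: p_def)
        next
          case False
          then show ?thesis by (intro exI[of _ j]) (auto simp: p_def)
        qed
      qed
    qed (auto simp: p_def split: if_splits)
  qed
  have "T ((\<lambda>i. z (Suc i))(Suc k := z 0)) = T (z \<circ> p)"
    by (rule multilinear_map_cong[OF T_ml]) (auto simp: p_def)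
  also have "\<dots> = T z"
    using T_sym p unfolding symmetric_map_def by blast
  finally have "\<omega> (z 0) (z (Suc k) - z 1) = c * T z"
    using E1 \<omega>_increment[of "z 0" "\<lambda>i. z (Suc i)"] unfolding recurrence_def by simp
  moreover have "\<omega> (z (Suc k)) (z k - z 0) = c * T z"
    using E0 \<omega>_increment[of "z (Suc k)" z] unfolding recurrence_def by simp
  ultimately show ?thesis
    using \<omega>_skew[of "z (Suc k)" "z 0"] \<omega>_skew[of "z (Suc k)" "z k"]
    by (simp add: symplectic_form_diff_right)
qed

text \<open>Along an orbit \<open>z\<close>, this is \<open>pairing_shift\<close> applied at offset
  \<open>i\<close>, which needs the recurrence on windows \<open>i\<close> and \<open>i + 1\<close>.
  For \<open>i + 1 = k\<close> the second window lies one step past the orbit and is supplied by the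
  solvability at \<open>y\<close>.\<close>

lemma consecutive_pairing_integral:
  assumes i: "i < k"
  shows "iterate_integral k (step_map e k recurrence) (consecutive_pairing e k recurrence \<Omega> i)"
  unfolding iterate_integral_def
proof (intro allI impI)
  fix x y
  assume xy: "partial_iterate k (step_map e k recurrence) x = Some y"
    and dx: "x \<in> dom (consecutive_pairing e k recurrence \<Omega> i)"
    and dy: "y \<in> dom (consecutive_pairing e k recurrence \<Omega> i)"
  have "\<exists>z. (\<forall>i<k. z i = x $ e i) \<and> (\<forall>i<k. z (k + i) = y $ e i) \<and>
      (\<forall>j<k. recurrence (\<lambda>i. z (j + i)))"
    by (rule step_map_iterate_orbit[OF e _ xy]) (rule recurrence_cong)
  then obtain z where z: "\<And>i. i < k \<Longrightarrow> z i = x $ e i" "\<And>i. i < k \<Longrightarrow> z (k + i) = y $ e i"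
    "\<And>j. j < k \<Longrightarrow> recurrence (\<lambda>i. z (j + i))"
    by blast
  show "consecutive_pairing e k recurrence \<Omega> i y = consecutive_pairing e k recurrence \<Omega> i x"
  proof (cases "Suc i < k")
    case True
    have "\<omega> (z (i + k)) (z (i + Suc k)) = \<omega> (z (i + 0)) (z (i + 1))"
      using z(3)[of i] z(3)[of "Suc i"] True by (intro pairing_shift) simp_all
    then show ?thesis
      using True z(1)[of i] z(1)[of "Suc i"] z(2)[of i] z(2)[of "Suc i"]
      by (simp add: consecutive_pairing_def add.commute)
  next
    case False
    then have ik: "k = Suc i" using i by simp
    from dx dy False obtain u v where u: "next_point e k recurrence x = Some u"
      and v: "next_point e k recurrence y = Some v"
      by (auto simp: consecutive_pairing_def)
    \<comment> \<open>The orbit determines only the entries below \<open>k + k\<close>; the next one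
      is the point following \<open>y\<close>.\<close>
    define z' where "z' = z(k + k := v)"
    have E0: "recurrence (\<lambda>l. z' (i + l))"
      by (rule recurrence_cong[OF _ z(3)[OF i]]) (simp add: z'_def ik)
    have E1: "recurrence (\<lambda>l. z' (i + Suc l))"
      by (rule recurrence_cong[OF _ next_point_SomeD(1)[OF v]])
        (use z(2) in \<open>auto simp: z'_def extend_def ik\<close>)
    have "\<omega> (z' (i + k)) (z' (i + Suc k)) = \<omega> (z' (i + 0)) (z' (i + 1))"
      using E0 E1 by (rule pairing_shift)
    moreover have "z' (i + k) = y $ e i" "z' (i + Suc k) = v" "z' (i + 0) = x $ e i"
      using z(1)[of i] z(2)[of i] i by (auto simp: z'_def ik add.commute)
    \<comment> \<open>Window \<open>0\<close> says that \<open>z k\<close> solves the equation at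
      \<open>x\<close>, and the solution \<open>u\<close> is unique.\<close>
    moreover have "z' (i + 1) = u"
    proof -
      have "recurrence (extend e k x (z k))"
        by (rule recurrence_cong[OF _ z(3)[of 0]]) (use z(1) i in \<open>auto simp: extend_def\<close>)
      from next_point_SomeD(2)[OF u this] show ?thesis
        by (simp add: z'_def ik)
    qed
    ultimately show ?thesis
      using False u v by (simp add: consecutive_pairing_def)
  qed
qed

section \<open>Solving for the new point by Cramer's rule\<close>

lemma linear_increment_extend: "linear (\<lambda>v. increment (extend e k x v))"
proof -
  have "increment (extend e k x v) = increment ((extend e k x 0)(k := v))" for v
    by (rule multilinear_map_cong[OF multilinear_map_increment]) (auto simp: extend_def)
  then show ?thesis
    using multilinear_map_linear[OF multilinear_map_increment, of k "extend e k x 0"] by simp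
qed

text \<open>Coefficient matrix of the linear equation for \<open>x\<^sub>k\<close>, with the unknown
  collected on the left and \<open>x\<^sub>0\<close> on the right.\<close>

definition system :: "real ^ 'n ^ 'k \<Rightarrow> real ^ 'n ^ 'n" where
  "system x = matrix (\<lambda>v. v - increment (extend e k x v))"

definition denom :: "real ^ 'n ^ 'k \<Rightarrow> real" where
  "denom x = det (system x)"

text \<open>Cramer's numerators, kept apart from \<open>denom\<close> so that both are polynomial in
  \<open>x\<close>.\<close>

definition numer :: "real ^ 'n ^ 'k \<Rightarrow> real ^ 'n" where
  "numer x = (\<chi> a. det (\<chi> i j. if j = a then x $ e 0 $ i else system x $ i $ j))"

lemma system_mult: "system x *v v = v - increment (extend e k x v)"
  unfolding system_def
  by (rule matrix_works, unfold linear_matrix_vector_mul_eq)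
    (intro linear_compose_sub linear_ident linear_increment_extend)

lemma recurrence_extend_iff: "recurrence (extend e k x v) \<longleftrightarrow> system x *v v = x $ e 0"
  using k by (auto simp: recurrence_def system_mult extend_def algebra_simps)

lemma system_solution:
  assumes "denom x \<noteq> 0"
  shows "system x *v v = x $ e 0 \<longleftrightarrow> v = numer x /\<^sub>R denom x"
  using cramer[of "system x" v "x $ e 0"] assms
  by (auto simp: denom_def numer_def vec_eq_iff divide_inverse_commute)

lemma next_point_denom:
  assumes "denom x \<noteq> 0"
  shows "next_point e k recurrence x = Some (numer x /\<^sub>R denom x)"
  by (rule next_point_eq_Some) (simp add: recurrence_extend_iff system_solution[OF assms])

lemma polynomial_function_increment:
  fixes g :: "nat \<Rightarrow> 'a::real_normed_vector \<Rightarrow> real ^ 'n"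
  assumes "\<And>i. i \<le> k \<Longrightarrow> polynomial_function (g i)"
  shows "polynomial_function (\<lambda>x. increment (\<lambda>i. g i x))"
proof -
  have "real_polynomial_function (\<lambda>x. contract k T (\<lambda>i. g i x) \<bullet> b)" for b
  proof -
    have "real_polynomial_function (\<lambda>x. T (\<lambda>i. (g(Suc k := (\<lambda>_. b))) i x))"
      by (rule real_polynomial_function_multilinear_map[OF T_ml])
        (use assms in \<open>auto simp: less_Suc_eq\<close>)
    moreover have "(\<lambda>i. (g(Suc k := (\<lambda>_. b))) i x) = (\<lambda>i. g i x)(Suc k := b)" for x
      by auto
    ultimately show ?thesis by (simp add: contract_inner[OF T_ml])
  qed
  then have "polynomial_function (\<lambda>x. contract k T (\<lambda>i. g i x))"
    by (simp add: polynomial_function_iff_Basis_inner)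
  then show ?thesis
    unfolding increment_def
    by (intro polynomial_function_cmul polynomial_function_linear_compose[of "(*v) (matrix_inv \<Omega>)"]
        matrix_vector_mul_linear)
qed

lemma real_polynomial_function_system: "real_polynomial_function (\<lambda>x. system x $ i $ j)"
proof -
  have "polynomial_function (\<lambda>x. axis j 1 - increment (\<lambda>l. extend e k x (axis j (1 :: real)) l))"
  proof (intro polynomial_function_diff polynomial_function_const polynomial_function_increment)
    show "polynomial_function (\<lambda>x. extend e k x (axis j (1 :: real)) l)" for l
      using polynomial_function_vec_nth[OF polynomial_function_id, of "e l"]
      by (cases "l < k") (simp_all add: extend_def)
  qed
  from real_polynomial_function_nth[OF this, of i] show ?thesis
    by (simp add: system_def matrix_def)
qed

lemma real_polynomial_function_denom: "real_polynomial_function denom"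
  unfolding denom_def[abs_def]
  by (intro real_polynomial_function_det real_polynomial_function_system)

lemma polynomial_function_numer: "polynomial_function numer"
proof (rule polynomial_function_vecI)
  fix a
  have "real_polynomial_function (\<lambda>x. det (\<chi> i j. if j = a then x $ e 0 $ i else system x $ i $ j))"
  proof (rule real_polynomial_function_det)
    fix i j
    have "real_polynomial_function (\<lambda>x :: real ^ 'n ^ 'k. x $ e 0 $ i)"
      by (intro real_polynomial_function_nth polynomial_function_vec_nth polynomial_function_id)
    then show "real_polynomial_function (\<lambda>x. (\<chi> i j. if j = a then x $ e 0 $ i else system x $ i $ j) $ i $ j)"
      by (cases "j = a") (simp_all add: real_polynomial_function_system)
  qed
  then show "polynomial_function (\<lambda>x. numer x $ a)"
    by (simp add: numer_def real_polynomial_function_eq)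
qed

section \<open>The derivative of the last pairing along a special direction\<close>

text \<open>
  Moving \<open>x\<^sub>0\<close> in the direction \<open>x\<^sub>1\<close> leaves \<open>\<omega>(x\<^sub>i, x\<^bsub>i+1\<^esub>)\<close> unchanged for \<open>i + 1 < k\<close>. For
  \<open>k = 1\<close> there is nothing to preserve and a constant direction \<open>p\<close> is used.
\<close>

definition direction :: "real ^ 'n \<Rightarrow> real ^ 'n ^ 'k \<Rightarrow> real ^ 'n ^ 'k" where
  "direction p x = axis (e 0) (if k = 1 then p else x $ e 1)"

text \<open>The curve \<open>(s p, p, \<dots>, p)\<close> is an integral curve of
  \<open>direction p\<close>. At the degenerate point \<open>s = 0\<close> the increment vanishes,
  which makes \<open>denom\<close> and \<open>numer\<close> explicit there.\<close>

definition ray :: "real ^ 'n \<Rightarrow> real \<Rightarrow> real ^ 'n ^ 'k" where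
  "ray p s = (\<chi> j. if j = e 0 then s *\<^sub>R p else p)"

lemma e_eq_iff: "i < k \<Longrightarrow> j < k \<Longrightarrow> e i = e j \<longleftrightarrow> i = j"
  using e by (auto simp: bij_betw_def inj_on_def)

lemma direction_ray: "direction p (ray p s) = axis (e 0) p"
  using k e_eq_iff[of 1 0] by (simp add: direction_def ray_def)

lemma has_derivative_ray: "(ray p has_derivative (\<lambda>t. t *\<^sub>R direction p (ray p s))) (at s)"
proof -
  have "ray p = (\<lambda>s. ray p 0 + s *\<^sub>R axis (e 0) p)"
    by (auto simp: ray_def fun_eq_iff vec_eq_iff axis_def)
  moreover have "((\<lambda>s. ray p 0 + s *\<^sub>R axis (e 0) p) has_derivative (\<lambda>t. t *\<^sub>R axis (e 0) p)) (at s)"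
    by (auto intro!: derivative_eq_intros)
  ultimately show ?thesis by (simp add: direction_ray)
qed

lemma polynomial_function_direction: "polynomial_function (direction p)"
proof (rule polynomial_function_vecI)
  fix j
  show "polynomial_function (\<lambda>x. direction p x $ j)"
    unfolding direction_def
    by (cases "k = 1"; cases "j = e 0") (auto simp: axis_def intro: polynomial_function_vec_nth[OF polynomial_function_id])
qed

text \<open>Numerator of the last pairing, whose denominator is \<open>denom\<close>.\<close>

definition last_numer :: "real ^ 'n ^ 'k \<Rightarrow> real" where
  "last_numer x = \<omega> (x $ e (k - 1)) (numer x)"

lemma real_polynomial_function_last_numer: "real_polynomial_function last_numer"
  unfolding last_numer_def[abs_def]
  by (intro real_polynomial_function_symplectic_form polynomial_function_vec_nth
      polynomial_function_numer polynomial_function_id)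

lemma increment_ray: "increment (extend e k (ray p s) v) = s *\<^sub>R increment (extend e k (\<chi> j. p) v)"
proof -
  have "increment (extend e k (ray p s) v) = increment ((extend e k (\<chi> j. p) v)(0 := s *\<^sub>R p))"
    using k e_eq_iff by (intro multilinear_map_cong[OF multilinear_map_increment]) (auto simp: extend_def ray_def)
  also have "\<dots> = s *\<^sub>R increment ((extend e k (\<chi> j. p) v)(0 := p))"
    by (rule linear_cmul[OF multilinear_map_linear[OF multilinear_map_increment]]) simp
  also have "(extend e k (\<chi> j. p) v)(0 := p) = extend e k (\<chi> j. p) v"
    using k by (auto simp: extend_def)
  finally show ?thesis .
qed

lemma denom_ray_0: "denom (ray p 0) = 1"
proof -
  have "system (ray p 0) = mat 1"
    by (rule matrix_eq[THEN iffD2]) (simp add: system_mult increment_ray)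
  then show ?thesis by (simp add: denom_def)
qed

lemma numer_ray_0: "numer (ray p 0) = 0"
proof -
  have "denom (ray p 0) \<noteq> 0" by (simp add: denom_ray_0)
  from system_solution[OF this, of 0] show ?thesis
    by (simp add: denom_ray_0) (simp add: ray_def)
qed

text \<open>
  If the derivative of \<open>last_numer / denom\<close> along \<open>direction p\<close> vanished identically, then
  \<open>\<omega>(p, x\<^sub>k)\<close> would vanish along the ray \<open>(s p, p, \<dots>, p)\<close> for small \<open>s\<close>. But there
  \<open>x\<^sub>k = s p + s L x\<^sub>k = s p + s\<^sup>2 L p + O(s\<^sup>3)\<close>, and \<open>\<omega>(p, L p) = c T(p, \<dots>, p)\<close> is nonzero.
\<close>

lemma direction_derivative_nonzero:
  assumes p: "T (\<lambda>_. p) \<noteq> 0"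
    and R': "\<And>x. (last_numer has_derivative R' x) (at x)"
    and d': "\<And>x. (denom has_derivative d' x) (at x)"
  shows "\<exists>x. R' x (direction p x) * denom x - last_numer x * d' x (direction p x) \<noteq> 0"
proof (rule ccontr)
  assume "\<not> ?thesis"
  then have Q0: "R' x (direction p x) * denom x = last_numer x * d' x (direction p x)" for x
    by simp
  define L where "L v = increment (extend e k (\<chi> j. p) v)" for v
  have lin: "linear L"
    unfolding L_def by (rule linear_increment_extend)
  have ray_cont: "isCont (ray p) s" for s
    using has_derivative_continuous[OF has_derivative_ray] .
  have denom_cont: "isCont denom x" for x
    using has_derivative_continuous[OF d'] .
  have "isCont (\<lambda>s. denom (ray p s)) 0"
    by (rule isCont_o2[OF ray_cont denom_cont])
  from continuous_at_avoid[OF this, of 0]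
  obtain b where b: "0 < b" "\<And>s. \<bar>s\<bar> < b \<Longrightarrow> denom (ray p s) \<noteq> 0"
    by (auto simp: denom_ray_0 dist_real_def)
  \<comment> \<open>Along the ray, the quotient rule produces exactly the expression assumed to
    vanish, so the quotient is constant near \<open>s = 0\<close>.\<close>
  have "\<exists>a. \<forall>s\<in>{-b<..<b}. last_numer (ray p s) / denom (ray p s) = a"
  proof (rule has_derivative_zero_constant)
    show "convex {-b<..<b}" by simp
    fix s assume s: "s \<in> {-b<..<b}"
    then have nz: "denom (ray p s) \<noteq> 0" using b(2) by auto
    have "linear (R' (ray p s))" "linear (d' (ray p s))"
      using has_derivative_linear R' d' by blast+
    then have "R' (ray p s) (t *\<^sub>R direction p (ray p s)) * denom (ray p s)
        = last_numer (ray p s) * d' (ray p s) (t *\<^sub>R direction p (ray p s))" for t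
      using Q0[of "ray p s"] by (simp add: linear_cmul)
    moreover have "((\<lambda>s. last_numer (ray p s) / denom (ray p s)) has_derivative
        (\<lambda>t. (R' (ray p s) (t *\<^sub>R direction p (ray p s)) * denom (ray p s)
           - last_numer (ray p s) * d' (ray p s) (t *\<^sub>R direction p (ray p s)))
           / (denom (ray p s) * denom (ray p s)))) (at s within {-b<..<b})"
      by (rule has_derivative_divide'[OF
            has_derivative_compose[OF has_derivative_at_withinI[OF has_derivative_ray] R']
            has_derivative_compose[OF has_derivative_at_withinI[OF has_derivative_ray] d'] nz])
    ultimately show "((\<lambda>s. last_numer (ray p s) / denom (ray p s)) has_derivative (\<lambda>_. 0))
        (at s within {-b<..<b})"
      by simp
  qed
  then obtain a where a: "\<And>s. \<bar>s\<bar> < b \<Longrightarrow> last_numer (ray p s) / denom (ray p s) = a"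
    by (auto simp: abs_less_iff)
  have "a = 0"
    using a[of 0] b(1) by (simp add: last_numer_def numer_ray_0 symplectic_form_def)
  \<comment> \<open>Write \<open>N\<close> for \<open>numer\<close> and \<open>d\<close> for
    \<open>denom\<close> on the ray. The linear system reads \<open>N = s (d p + L N)\<close>;
    substituting it twice into \<open>\<omega> p N = 0\<close>, with
    \<open>\<omega> p p = 0\<close>, allows two factors \<open>s\<close> to be cancelled.\<close>
  have \<theta>0: "denom (ray p s) * \<omega> p (L p) + \<omega> p (L (L (numer (ray p s)))) = 0" if s: "0 < s" "s < b" for s
  proof -
    let ?N = "numer (ray p s)" and ?d = "denom (ray p s)"
    have nz: "?d \<noteq> 0" using s b by simp
    have "last_numer (ray p s) = 0"
      using a[of s] nz s \<open>a = 0\<close> by simp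
    \<comment> \<open>The last entry of the ray is \<open>s p\<close> if \<open>k = 1\<close> and
      \<open>p\<close> otherwise; the scalar is nonzero in both cases.\<close>
    then have pN: "\<omega> p ?N = 0"
      using s by (auto simp: last_numer_def ray_def symplectic_form_scale_left split: if_splits)
    have "system (ray p s) *v (?N /\<^sub>R ?d) = s *\<^sub>R p"
      using system_solution[OF nz, of "?N /\<^sub>R ?d"] by (simp add: ray_def)
    then have "?d *\<^sub>R (system (ray p s) *v (?N /\<^sub>R ?d)) = ?d *\<^sub>R s *\<^sub>R p"
      by simp
    then have "system (ray p s) *v ?N = (?d * s) *\<^sub>R p"
      using nz by (simp add: matrix_vector_mult_scaleR)
    then have N: "?N = s *\<^sub>R (?d *\<^sub>R p + L ?N)"
      by (simp add: system_mult increment_ray L_def algebra_simps)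
    have "\<omega> p ?N = s * (?d * \<omega> p p + \<omega> p (L ?N))"
      by (subst N) (simp only: symplectic_form_scale_right symplectic_form_add_right)
    then have "\<omega> p (L ?N) = 0"
      using pN s \<omega>_self by simp
    moreover have "L ?N = s *\<^sub>R (?d *\<^sub>R L p + L (L ?N))"
      by (subst N) (simp only: linear_cmul[OF lin] linear_add[OF lin])
    ultimately have "s * (?d * \<omega> p (L p) + \<omega> p (L (L ?N))) = 0"
      by (metis symplectic_form_scale_right symplectic_form_add_right)
    then show ?thesis using s by simp
  qed
  have "isCont (\<lambda>s. denom (ray p s) * \<omega> p (L p) + \<omega> p (L (L (numer (ray p s))))) 0"
  proof -
    have numer_cont: "isCont (\<lambda>s. numer (ray p s)) 0"
      by (rule isCont_o2[OF ray_cont continuous_polymonial_function[OF polynomial_function_numer]])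
    have "bounded_linear L"
      using lin by (simp only: linear_conv_bounded_linear)
    from bounded_linear_compose[OF bounded_bilinear.bounded_linear_right[OF
        bounded_bilinear_symplectic_form[of \<Omega>], of p] bounded_linear_compose[OF this this]]
    have "isCont (\<lambda>s. \<omega> p (L (L (numer (ray p s))))) 0"
      by (rule bounded_linear.isCont) (rule numer_cont)
    with isCont_o2[OF ray_cont denom_cont] show ?thesis
      by (intro continuous_add continuous_mult continuous_const)
  qed
  \<comment> \<open>As \<open>s\<close> tends to 0 from the right, \<open>denom\<close> tends to 1
    and \<open>numer\<close> to 0, so only \<open>\<omega> p (L p)\<close> survives.\<close>
  then have lim: "((\<lambda>s. denom (ray p s) * \<omega> p (L p) + \<omega> p (L (L (numer (ray p s))))) \<longlongrightarrow>
      denom (ray p 0) * \<omega> p (L p) + \<omega> p (L (L (numer (ray p 0))))) (at_right 0)"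
    unfolding isCont_def by (rule filterlim_mono[OF _ order_refl at_le]) simp
  have ev: "\<forall>\<^sub>F s in at_right 0.
      denom (ray p s) * \<omega> p (L p) + \<omega> p (L (L (numer (ray p s)))) = 0"
    using b(1) \<theta>0 by (auto simp: eventually_at_right_field)
  from lim have "((\<lambda>s. 0) \<longlongrightarrow>
      denom (ray p 0) * \<omega> p (L p) + \<omega> p (L (L (numer (ray p 0))))) (at_right (0 :: real))"
    by (simp only: tendsto_cong[OF ev])
  then have "denom (ray p 0) * \<omega> p (L p) + \<omega> p (L (L (numer (ray p 0)))) = 0"
    by (intro tendsto_unique[OF _ _ tendsto_const]) simp_all
  then have "\<omega> p (L p) = 0"
    using linear_0[OF lin] by (simp add: denom_ray_0 numer_ray_0 symplectic_form_def)
  moreover have "\<omega> p (L p) = c * T (\<lambda>_. p)"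
  proof -
    have "T ((extend e k (\<chi> j. p) p)(Suc k := p)) = T (\<lambda>_. p)"
      by (rule multilinear_map_cong[OF T_ml]) (simp add: extend_def)
    then show ?thesis by (simp add: L_def \<omega>_increment)
  qed
  ultimately show False using p c_nonzero by simp
qed

section \<open>Functional independence of the pairings\<close>

lemma derivative_pairing:
  "((\<lambda>x :: real ^ 'n ^ 'k. \<omega> (x $ i) (x $ j)) has_derivative
      (\<lambda>v. \<omega> (x $ i) (v $ j) + \<omega> (v $ i) (x $ j))) (at x)"
  by (rule bounded_bilinear.FDERIV[OF bounded_bilinear_symplectic_form];
      rule bounded_linear_imp_has_derivative[OF bounded_linear_vec_nth])

text \<open>The differentials are triangular: a variation of entry \<open>i\<close> alone affects
  only the pairings \<open>i - 1\<close> and \<open>i\<close>, and the coefficient of the former is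
  already zero by induction.\<close>

lemma pairing_derivatives_independent:
  fixes a :: "nat \<Rightarrow> real"
  assumes x: "\<And>j. x $ j \<noteq> 0"
    and a: "\<And>v :: real ^ 'n ^ 'k.
      (\<Sum>i<k - 1. a i * (\<omega> (x $ e i) (v $ e (Suc i)) + \<omega> (v $ e i) (x $ e (Suc i)))) = 0"
  shows "i < k - 1 \<Longrightarrow> a i = 0"
proof (induction i rule: less_induct)
  case (less i)
  \<comment> \<open>With this choice \<open>\<omega> u (x $ e (Suc i))\<close> is the squared norm
    of \<open>u\<close>.\<close>
  define u where "u = \<Omega> *v (x $ e (Suc i))"
  have "(\<Sum>l<k - 1. a l * (\<omega> (x $ e l) (axis (e i) u $ e (Suc l)) + \<omega> (axis (e i) u $ e l) (x $ e (Suc l))))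
      = (\<Sum>l<k - 1. if l = i then a i * \<omega> u (x $ e (Suc i)) else 0)"
  proof (rule sum.cong[OF refl])
    fix l assume l: "l \<in> {..<k - 1}"
    have "e l = e i \<longleftrightarrow> l = i" "e (Suc l) = e i \<longleftrightarrow> Suc l = i"
      using l less.prems by (auto simp: e_eq_iff)
    then show "a l * (\<omega> (x $ e l) (axis (e i) u $ e (Suc l)) + \<omega> (axis (e i) u $ e l) (x $ e (Suc l)))
        = (if l = i then a i * \<omega> u (x $ e (Suc i)) else 0)"
      using less.IH[of l] less.prems
      by (auto simp: axis_def symplectic_form_def)
  qed
  then have "a i * \<omega> u (x $ e (Suc i)) = 0"
    using a[of "axis (e i) u"] less.prems by simp
  moreover have "\<omega> u (x $ e (Suc i)) \<noteq> 0"
    using \<Omega>_mult_nonzero[OF x] by (simp add: symplectic_form_def u_def)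
  ultimately show "a i = 0" by simp
qed

lemma consecutive_pairings_independent:
  assumes p: "T (\<lambda>_. p) \<noteq> 0"
  shows "functionally_independent k (consecutive_pairing e k recurrence \<Omega>)"
proof -
  let ?I = "consecutive_pairing e k recurrence \<Omega>"
  obtain R' where R': "\<And>x. (last_numer has_derivative R' x) (at x)"
    "\<And>w. polynomial_function w \<Longrightarrow> real_polynomial_function (\<lambda>x. R' x (w x))"
    using real_polynomial_function_derivative[OF real_polynomial_function_last_numer] by blast
  obtain d' where d': "\<And>x. (denom has_derivative d' x) (at x)"
    "\<And>w. polynomial_function w \<Longrightarrow> real_polynomial_function (\<lambda>x. d' x (w x))"
    using real_polynomial_function_derivative[OF real_polynomial_function_denom] by blast
  \<comment> \<open>Three nonvanishing conditions define the dense open set: \<open>denom\<close>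
    makes the last pairing rational, \<open>N\<close> makes all entries nonzero, and
    \<open>Q\<close>, the numerator of the derivative along \<open>direction p\<close>, detects the
    last pairing.\<close>
  define Q where "Q x = R' x (direction p x) * denom x - last_numer x * d' x (direction p x)" for x
  define N where "N x = (\<Prod>j\<in>UNIV. x $ j \<bullet> x $ j)" for x :: "real ^ 'n ^ 'k"
  define P where "P x = (denom x * N x) * Q x" for x
  have Q: "real_polynomial_function Q"
    unfolding Q_def[abs_def]
    by (intro real_polynomial_function_diff real_polynomial_function.intros(4) R'(2) d'(2)
        polynomial_function_direction real_polynomial_function_denom real_polynomial_function_last_numer)
  obtain q where q: "Q q \<noteq> 0"
    using direction_derivative_nonzero[OF p R'(1) d'(1)] unfolding Q_def by blast
  have N: "real_polynomial_function N"
    unfolding N_def[abs_def]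
    by (intro real_polynomial_function_prod real_polynomial_function_inner
        polynomial_function_vec_nth polynomial_function_id) simp
  have "p \<noteq> 0"
  proof
    assume "p = 0"
    have "T ((\<lambda>_. p)(0 := 0)) = 0"
      by (rule linear_0[OF multilinear_map_linear[OF T_ml]]) simp
    moreover have "(\<lambda>_. p)(0 := 0) = (\<lambda>_ :: nat. p)"
      using \<open>p = 0\<close> by auto
    ultimately show False using p by simp
  qed
  then have "N (\<chi> j. p) \<noteq> 0"
    by (simp add: N_def)
  moreover have "denom (ray p 0) \<noteq> 0"
    by (simp add: denom_ray_0)
  ultimately obtain z where "denom z * N z \<noteq> 0"
    using real_polynomial_mult_nonzero real_polynomial_function_denom N by metis
  from real_polynomial_mult_nonzero[OF real_polynomial_function.intros(4)[OF real_polynomial_function_denom N] this Q q]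
  obtain y where y: "P y \<noteq> 0"
    unfolding P_def by blast
  have P: "real_polynomial_function P"
    unfolding P_def[abs_def]
    by (intro real_polynomial_function.intros(4) real_polynomial_function_denom N Q)
  define U where "U = {x. P x \<noteq> 0}"
  have U: "denom x \<noteq> 0" "\<And>j. x $ j \<noteq> 0" "Q x \<noteq> 0" if "x \<in> U" for x
    using that by (auto simp: U_def P_def N_def)
  have U_open: "open U"
    unfolding U_def by (rule open_real_polynomial_nonzero[OF P])
  have I_last: "?I (k - 1) x = Some (last_numer x / denom x)" if "x \<in> U" for x
    using next_point_denom[OF U(1)[OF that]] k
    by (simp add: consecutive_pairing_def last_numer_def symplectic_form_scale_right divide_inverse_commute)
  have I_other: "?I i x = Some (\<omega> (x $ e i) (x $ e (Suc i)))" if "i < k - 1" for i x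
    using that by (simp add: consecutive_pairing_def less_diff_conv)
  define D where "D x i = (if i < k - 1
      then (\<lambda>v. \<omega> (x $ e i) (v $ e (Suc i)) + \<omega> (v $ e i) (x $ e (Suc i)))
      else (\<lambda>v. (R' x v * denom x - last_numer x * d' x v) / (denom x * denom x)))" for x i
  have D: "((\<lambda>y. the (?I i y)) has_derivative D x i) (at x)" if x: "x \<in> U" and i: "i < k" for x i
  proof (cases "i < k - 1")
    case True
    then show ?thesis
      using derivative_pairing by (simp add: D_def I_other)
  next
    case False
    then have i: "i = k - 1" using i by simp
    have "((\<lambda>y. last_numer y / denom y) has_derivative D x i) (at x)"
      using has_derivative_divide'[OF R'(1) d'(1) U(1)[OF x]] False by (simp add: D_def)
    then show ?thesis
      \<comment> \<open>The pairing is known to equal the quotient only on \<open>U\<close>;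
        openness transfers the derivative.\<close>
      by (rule has_derivative_transform_within_open[OF _ U_open x]) (simp add: I_last i del: One_nat_def)
  qed
  have indep: "a i = 0" if x: "x \<in> U" and a: "\<And>v. (\<Sum>i<k. a i * D x i v) = 0" and i: "i < k"
    for x i and a :: "nat \<Rightarrow> real"
  proof -
    have split: "(\<Sum>i<k. a i * D x i v) = (\<Sum>i<k - 1. a i * D x i v) + a (k - 1) * D x (k - 1) v" for v
      using k sum.lessThan_Suc[of "\<lambda>i. a i * D x i v" "k - 1"] by simp
    \<comment> \<open>Only \<open>x\<^sub>0\<close> moves, in the direction
      \<open>x\<^sub>1\<close>; the one pairing affected changes by
      \<open>\<omega>(x\<^sub>1, x\<^sub>1) = 0\<close>. Testing a relation on
      \<open>direction p x\<close> therefore isolates its last coefficient.\<close>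
    have "D x i (direction p x) = 0" if "i < k - 1" for i
    proof -
      have "e (Suc i) \<noteq> e 0" "e i = e 0 \<longleftrightarrow> i = 0" "k \<noteq> 1"
        using that by (auto simp: e_eq_iff)
      then show ?thesis
        using that by (auto simp: D_def direction_def axis_def symplectic_form_def[of _ _ 0]
            symplectic_form_def[of _ 0] \<omega>_self)
    qed
    then have "a (k - 1) * D x (k - 1) (direction p x) = 0"
      using a[of "direction p x"] unfolding split by simp
    then have last: "a (k - 1) = 0"
      using U[OF x] by (simp add: D_def Q_def)
    show ?thesis
    proof (cases "i < k - 1")
      case True
      show ?thesis
      proof (rule pairing_derivatives_independent[OF U(2)[OF x] _ True])
        fix v :: "real ^ 'n ^ 'k"
        show "(\<Sum>i<k - 1. a i * (\<omega> (x $ e i) (v $ e (Suc i)) + \<omega> (v $ e i) (x $ e (Suc i)))) = 0"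
          using a[of v] using last unfolding split by (simp add: D_def del: One_nat_def)
      qed
    next
      case False
      then have "i = k - 1" using i by simp
      then show ?thesis using last by simp
    qed
  qed
  show ?thesis
    unfolding functionally_independent_def
  proof (intro exI[of _ U] conjI ballI)
    show "closure U = UNIV"
      unfolding U_def by (rule closure_real_polynomial_nonzero[OF P y])
    show "\<forall>i<k. U \<subseteq> dom (?I i)"
    proof (intro allI impI subsetI)
      fix i x assume "i < k" "x \<in> U"
      then have "i < k - 1 \<or> i = k - 1" by linarith
      then show "x \<in> dom (?I i)"
        using I_last[OF \<open>x \<in> U\<close>] I_other[of i x] by blast
    qed
    fix x assume "x \<in> U"
    then show "\<exists>D. (\<forall>i<k. ((\<lambda>y. the (?I i y)) has_derivative D i) (at x)) \<and>
        (\<forall>c. (\<forall>v. (\<Sum>i<k. c i * D i v) = 0) \<longrightarrow> (\<forall>i<k. c i = 0))"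
      using D indep by (intro exI[of _ "D x"]) blast
  qed (rule U_open)
qed

end

theorem proposition4:
  fixes k :: nat
    and e :: "nat \<Rightarrow> 'k::finite"
    and H :: "real ^ 'n \<Rightarrow> real"
    and T :: "(nat \<Rightarrow> real ^ 'n) \<Rightarrow> real"
    and \<Omega> K :: "real ^ 'n ^ 'n"
    and h :: real
    and f :: "real ^ 'n \<Rightarrow> real ^ 'n"
    and E :: "(nat \<Rightarrow> real ^ 'n) \<Rightarrow> bool"
  assumes "k \<ge> 1"
    and "bij_betw e {..<k} UNIV"
    and "homogeneous_polynomial (k + 2) H"
    and "\<exists>x. H x \<noteq> 0"
    and "multilinear_map (k + 2) T"
    and "symmetric_map (k + 2) T"
    and "\<And>x. H x = T (\<lambda>_. x) / fact (k + 2)"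
    and "invertible \<Omega>"
    and "transpose \<Omega> = - \<Omega>"
    and "K = matrix_inv \<Omega>"
    and "h \<noteq> 0"
    and "f = hamiltonian_vf \<Omega> H"
    and "\<And>z. E z \<longleftrightarrow>
           (z k - z 0) /\<^sub>R (real k * h) = (1 / fact (k + 1)) *\<^sub>R (K *v contract k T z)"
  shows "(\<forall>x. f x = (1 / fact (k + 1)) *\<^sub>R (K *v contract k T (\<lambda>_. x))) \<and>
         ((\<forall>z. polar_equation k h f z \<longleftrightarrow> E z) \<and> polar_map e k h f = step_map e k E) \<and>
         ((\<forall>i<k. iterate_integral k (polar_map e k h f) (consecutive_pairing e k E \<Omega> i)) \<and>
          functionally_independent k (consecutive_pairing e k E \<Omega>))"
proof -
  interpret polar_recurrence k e T \<Omega> h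
    using assms by unfold_locales
  have E: "E = recurrence"
    using assms(13) unfolding recurrence_iff \<open>K = matrix_inv \<Omega>\<close> by blast
  let ?F = "\<lambda>z. (1 / fact (k + 1)) *\<^sub>R (K *v contract k T z)"
  have f: "f x = ?F (\<lambda>_. x)" for x
    unfolding \<open>f = hamiltonian_vf \<Omega> H\<close> hamiltonian_vf_def \<open>K = matrix_inv \<Omega>\<close>
      gradient_homogeneous[OF assms(5,6), of H, OF assms(7)]
    by (simp add: matrix_vector_mult_scaleR)
  have "linear (\<lambda>w. (1 / fact (k + 1)) *\<^sub>R (K *v w))"
    by (intro linear_compose_scale_right matrix_vector_mul_linear)
  then have ml: "multilinear_map (Suc k) ?F"
    by (rule multilinear_map_compose_linear[OF multilinear_map_contract[OF assms(5)]])
  have sym: "symmetric_map (Suc k) ?F"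
    using symmetric_map_contract[OF assms(6)] unfolding symmetric_map_def by simp
  \<comment> \<open>The contracted tensor is a symmetric multilinear map with diagonal
    \<open>f\<close>, hence the polarization of \<open>f\<close>.\<close>
  have "polarization (Suc k) f = ?F"
    by (rule polarization_eqI[OF ml sym]) (rule f[symmetric])
  then have polar: "polar_equation k h f z \<longleftrightarrow> E z" for z
    by (simp add: polar_equation_def assms(13))
  then have "polar_equation k h f = E"
    by blast
  then have map: "polar_map e k h f = step_map e k E"
    by (simp add: polar_map_def)
  \<comment> \<open>A point where \<open>H\<close> does not vanish supplies the vector from which
    the ray is built.\<close>
  obtain p where "T (\<lambda>_. p) \<noteq> 0"
    using assms(4,7) by auto
  then have "functionally_independent k (consecutive_pairing e k E \<Omega>)"
    unfolding E by (rule consecutive_pairings_independent)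
  then show ?thesis
    using f polar map consecutive_pairing_integral by (simp add: E)
qed

end
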